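(* If $k$ is an integer of the form $k = 6^r - 1$ with $r \in \mathbb{N}$, $r \geq 2$, then the smallest positive period $P_k$ of $g_k$ satisfies $$P_k = \mathrm{lcm}(1, 2, \dots, k).$$ Consequently, there are infinitely many $k \in \mathbb{N}$ for which $k+1$ is not prime and the equality $P_k = \mathrm{lcm}(1, 2, \dots, k)$ holds.
   Context: $\mathbb{N}$ denotes the nonnegative integers and $\mathbb{N}^* = \mathbb{N} \setminus \{0\}$. For $k \in \mathbb{N}$, the function $g_k : \mathbb{N}^* \to \mathbb{N}^*$ is defined by $g_k(n) = \frac{n(n+1)\cdots(n+k)}{\mathrm{lcm}(n, n+1, \dots, n+k)}$. It is known that $g_k$ is periodic. $P_k$ denotes the exact (i.e. smallest positive) period of $g_k$: the least positive integer $T$ such that $g_k(n+T) = g_k(n)$ for all $n \in \mathbb{N}^*$. *)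

theory Defs
  imports "HOL-Computational_Algebra.Primes"
begin

text \<open>
  The function \<open>g\<^sub>k\<close> is only meaningful at positive arguments; its value at 0 is irrelevant
  and is never used below.  The truncating division on the naturals is exact here, as
  \<open>g_mult_Lcm\<close> shows.
\<close>

definition g :: "nat \<Rightarrow> nat \<Rightarrow> nat" where
  "g k n = (\<Prod>i = 0..k. n + i) div Lcm {n..n + k}"

lemma g_mult_Lcm: "g k n * Lcm {n..n + k} = (\<Prod>i = 0..k. n + i)"
proof -
  have "Lcm {n..n + k} dvd (\<Prod>i = 0..k. n + i)"
  proof (rule Lcm_least)
    fix m assume "m \<in> {n..n + k}"
    then have "m - n \<in> {0..k}" "n + (m - n) = m" by auto
    then show "m dvd (\<Prod>i = 0..k. n + i)"
      by (metis dvd_prodI finite_atLeastAtMost)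
  qed
  then show ?thesis
    unfolding g_def by (rule dvd_div_mult_self)
qed

definition is_period :: "(nat \<Rightarrow> nat) \<Rightarrow> nat \<Rightarrow> bool" where
  "is_period f T \<longleftrightarrow> T > 0 \<and> (\<forall>n>0. f (n + T) = f n)"

definition P :: "nat \<Rightarrow> nat" where
  "P k = (LEAST T. is_period (g k) T)"

end

theory Submission
  imports Defs
begin

text \<open>
  Write \<open>L = Lcm {1..k}\<close>. Since gcd distributes over lcm, consecutive values of \<open>g k\<close> satisfy
  \<open>g k (n + 1) * gcd n L = g k n * gcd (n + k + 1) L\<close>. Multiplying this over a complete residue system
  modulo \<open>L\<close> shows that \<open>L\<close> is a period. Conversely, comparing the recurrence at \<open>L\<close> and \<open>L + T\<close> for
  a period \<open>T\<close> gives \<open>gcd (k + 1) L * gcd T L = L * gcd (T + k + 1) L\<close>, whence \<open>L\<close> divides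
  \<open>lcm (k + 1) T\<close>. If every prime \<open>p\<close> dividing \<open>L\<close> has a higher multiplicity in \<open>L\<close> than in \<open>k + 1\<close>,
  then \<open>L\<close> already divides \<open>T\<close>; this is the case for \<open>k + 1 = 6 ^ r\<close> as \<open>3 ^ (r + 1) < 6 ^ r\<close>.
\<close>

lemma gcd_Lcm_distrib:
  fixes m :: nat
  assumes "finite A"
  shows "gcd m (Lcm A) = (LCM a\<in>A. gcd m a)"
  using assms by (induction A rule: finite_induct) (simp_all add: gcd_lcm_distrib)

text \<open>Each \<open>n + i\<close> has the same gcd with \<open>n\<close> as \<open>i\<close>
  does, and gcd distributes over \<open>Lcm\<close>.\<close>

lemma gcd_Lcm_above: "gcd n (Lcm {n + 1..n + k}) = gcd n (Lcm {1..k})" for n :: nat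
proof -
  have eq: "{n + 1..n + k} = (+) n ` {1..k}"
    by simp
  show ?thesis
    unfolding eq by (simp add: gcd_Lcm_distrib image_image del: image_add_atLeastAtMost)
qed

text \<open>Mirror image of the previous lemma: the block is read downwards from
  \<open>n + k + 1\<close>, and \<open>N - i\<close> has the same gcd with \<open>N\<close> as
  \<open>i\<close>.\<close>

lemma gcd_Lcm_below:
  "gcd (n + k + 1) (Lcm {n + 1..n + k}) = gcd (n + k + 1) (Lcm {1..k})" for n :: nat
proof -
  let ?f = "\<lambda>i. n + k + 1 - i"
  have eq: "{n + 1..n + k} = ?f ` {1..k}"
  proof
    show "{n + 1..n + k} \<subseteq> ?f ` {1..k}"
    proof
      fix x assume "x \<in> {n + 1..n + k}"
      then have "x = ?f (n + k + 1 - x)" "n + k + 1 - x \<in> {1..k}"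
        by auto
      then show "x \<in> ?f ` {1..k}"
        by blast
    qed
  qed auto
  have "gcd (n + k + 1) (?f i) = gcd (n + k + 1) i" if "i \<in> {1..k}" for i
  proof -
    have "i \<le> n + k + 1"
      using that by auto
    then show ?thesis
      by (metis gcd.commute gcd_add1 gcd_diff1_nat le_add_diff_inverse)
  qed
  then show ?thesis
    unfolding eq by (simp add: gcd_Lcm_distrib image_image)
qed

lemma g_pos:
  assumes "n > 0"
  shows "g k n > 0"
proof -
  have "g k n * Lcm {n..n + k} > 0"
    using assms by (simp add: g_mult_Lcm)
  then show ?thesis
    by simp
qed

text \<open>The windows starting at \<open>n\<close> and \<open>n + 1\<close> share the block from
  \<open>n + 1\<close> to \<open>n + k\<close>, with lcm \<open>M\<close> and product
  \<open>Q\<close>; they differ only in one end point each.\<close>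

lemma g_Suc:
  assumes "n > 0"
  shows "g k (n + 1) * gcd n (Lcm {1..k}) = g k n * gcd (n + k + 1) (Lcm {1..k})"
proof -
  define M where "M = Lcm {n + 1..n + k}"
  define Q where "Q = \<Prod>{n + 1..n + k}"
  have prod: "(\<Prod>i = 0..k. m + i) = \<Prod>{m..m + k}" for m :: nat
    using prod.shift_bounds_cl_nat_ivl[of "\<lambda>i. i" 0 m k] by (simp add: add.commute)
  have "{n..n + k} = insert n {n + 1..n + k}"
    by auto
  then have low: "g k n * lcm n M = n * Q"
    using g_mult_Lcm[of k n] by (simp add: prod M_def Q_def)
  have "{n + 1..n + 1 + k} = insert (n + k + 1) {n + 1..n + k}"
    by auto
  then have high: "g k (n + 1) * lcm (n + k + 1) M = (n + k + 1) * Q"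
    using g_mult_Lcm[of k "n + 1"] unfolding prod by (simp only: M_def Q_def) simp
  have "M > 0"
    unfolding M_def by (intro Nat.gr0I) (auto simp: Lcm_0_iff)
  \<comment> \<open>Multiplying by the gcd turns \<open>lcm n M\<close> into \<open>n * M\<close>,
    so that the end point \<open>n\<close> cancels.\<close>
  have "n * (g k n * M) = n * (Q * gcd n M)"
    using arg_cong[OF low, of "\<lambda>x. x * gcd n M"] prod_gcd_lcm_nat[of n M]
    by (simp add: ac_simps)
  then have 1: "g k n * M = Q * gcd n M"
    using assms by simp
  have "(n + k + 1) * (g k (n + 1) * M) = (n + k + 1) * (Q * gcd (n + k + 1) M)"
    using arg_cong[OF high, of "\<lambda>x. x * gcd (n + k + 1) M"] prod_gcd_lcm_nat[of "n + k + 1" M]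
    by (metis mult.assoc mult.commute)
  then have 2: "g k (n + 1) * M = Q * gcd (n + k + 1) M"
    by (metis add_gr_0 less_numeral_extra(1) mult_cancel1 less_numeral_extra(3))
  have "M * (g k (n + 1) * gcd n M) = M * (g k n * gcd (n + k + 1) M)"
    using 1 2 by (metis mult.assoc mult.commute)
  then have "g k (n + 1) * gcd n M = g k n * gcd (n + k + 1) M"
    using \<open>M > 0\<close> by simp
  then show ?thesis
    unfolding M_def gcd_Lcm_above gcd_Lcm_below .
qed

text \<open>Shifting the window by one trades the factor \<open>f m\<close> for the equal factor
  \<open>f (m + T)\<close>.\<close>

lemma prod_full_period:
  fixes f :: "nat \<Rightarrow> 'a::comm_monoid_mult"
  assumes "\<And>n. f (n + T) = f n"
  shows "prod f {m..<m + T} = prod f {0..<T}"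
proof (induction m)
  case (Suc m)
  show ?case
  proof (cases "T = 0")
    case False
    have "prod f {Suc m..<Suc m + T} = prod f {Suc m..<m + T} * f (m + T)"
      using False by simp
    also have "\<dots> = prod f {m..<m + T}"
      using False assms by (simp add: prod.atLeast_Suc_lessThan[of m] mult.commute)
    finally show ?thesis
      using Suc.IH by simp
  qed simp
qed simp

lemma is_period_Lcm: "is_period (g k) (Lcm {1..k})"
  unfolding is_period_def
proof (intro conjI allI impI)
  let ?L = "Lcm {1..k}" and ?f = "\<lambda>n. gcd n (Lcm {1..k})"
  show L: "?L > 0"
    by (intro Nat.gr0I) (auto simp: Lcm_0_iff)
  fix n :: nat assume "n > 0"
  \<comment> \<open>For \<open>N = ?L\<close> both products run over a full period of
    \<open>?f\<close>, hence agree and cancel.\<close>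
  have telescope: "g k (n + N) * prod ?f {n..<n + N} = g k n * prod ?f {n + (k + 1)..<n + (k + 1) + N}"
    for N
  proof (induction N)
    case (Suc N)
    have "g k (n + Suc N) * prod ?f {n..<n + Suc N}
        = (g k (n + N + 1) * ?f (n + N)) * prod ?f {n..<n + N}"
      by simp
    also have "\<dots> = (g k (n + N) * prod ?f {n..<n + N}) * ?f (n + N + k + 1)"
      using \<open>n > 0\<close> g_Suc[of "n + N" k] by (simp add: ac_simps)
    also have "\<dots> = g k n * prod ?f {n + (k + 1)..<n + (k + 1) + Suc N}"
      unfolding Suc.IH by (simp add: ac_simps)
    finally show ?case .
  qed simp
  have per: "?f (i + ?L) = ?f i" for i
    by simp
  have "prod ?f {0..<?L} > 0"
    using L by (intro prod_pos) auto
  then show "g k (n + ?L) = g k n"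
    using telescope[of ?L] unfolding prod_full_period[of ?f, OF per] by simp
qed

lemma Lcm_dvd_lcm_period:
  assumes "is_period (g k) T"
  shows "Lcm {1..k} dvd lcm (k + 1) T"
proof -
  define L where "L = Lcm {1..k}"
  have "L > 0"
    using is_period_Lcm unfolding is_period_def L_def by blast
  let ?x = "gcd (k + 1) L" and ?y = "gcd T L"
  have T: "g k (m + T) = g k m" if "m > 0" for m
    using assms that by (simp add: is_period_def)
  \<comment> \<open>The recurrence is used at \<open>L\<close>, a positive stand-in for 0: there
    \<open>gcd L L = L\<close> is as large as possible.\<close>
  have "g k (L + 1) * L = g k L * ?x"
    using g_Suc[of L k, folded L_def] \<open>L > 0\<close> gcd_add1[of "k + 1" L]
    by (simp add: add.commute)
  moreover have "g k (L + 1) * ?y = g k L * gcd (T + (k + 1)) L"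
  proof -
    have "gcd (L + T) L = ?y" "gcd (L + T + k + 1) L = gcd (T + (k + 1)) L"
      by (metis gcd_add1 add.commute, metis gcd_add1 add.commute add.assoc)
    then show ?thesis
      using g_Suc[of "L + T" k, folded L_def] T[of L] T[of "L + 1"] \<open>L > 0\<close>
      by (simp add: ac_simps)
  qed
  ultimately have "g k L * (g k (L + 1) * (?x * ?y))
      = g k L * (g k (L + 1) * (L * gcd (T + (k + 1)) L))"
    by (metis mult.assoc mult.commute)
  then have eq: "?x * ?y = L * gcd (T + (k + 1)) L"
    using g_pos[of L k] g_pos[of "L + 1" k] \<open>L > 0\<close> by simp
  \<comment> \<open>A common divisor of \<open>k + 1\<close> and \<open>T\<close> divides their
    sum.\<close>
  have "gcd ?x ?y dvd gcd (T + (k + 1)) L"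
    by (meson dvd_add dvd_trans gcd_dvd1 gcd_dvd2 gcd_greatest)
  then have "L * gcd ?x ?y dvd ?x * ?y"
    unfolding eq by (rule mult_dvd_mono[OF dvd_refl])
  also have "?x * ?y = lcm ?x ?y * gcd ?x ?y"
    by (metis prod_gcd_lcm_nat mult.commute)
  finally have "L dvd lcm ?x ?y"
    by (rule iffD1[OF dvd_times_right_cancel_iff, rotated]) (use \<open>L > 0\<close> in simp)
  also have "lcm ?x ?y dvd lcm (k + 1) T"
    by (intro lcm_mono gcd_dvd1)
  finally show ?thesis
    unfolding L_def .
qed

text \<open>The multiplicity of \<open>p\<close> in \<open>lcm (k + 1) (P k)\<close> is a maximum;
  as \<open>k + 1\<close> falls strictly short of \<open>Lcm {1..k}\<close> at \<open>p\<close>, the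
  bound must come from \<open>P k\<close>.\<close>

lemma P_eq_Lcm:
  assumes "\<And>p. prime p \<Longrightarrow> p dvd Lcm {1..k} \<Longrightarrow> multiplicity p (k + 1) < multiplicity p (Lcm {1..k})"
  shows "P k = Lcm {1..k}"
proof -
  let ?L = "Lcm {1..k}"
  have "is_period (g k) (P k)"
    unfolding P_def using is_period_Lcm by (rule LeastI)
  then have pos: "P k > 0" and dvd: "?L dvd lcm (k + 1) (P k)"
    by (simp add: is_period_def, rule Lcm_dvd_lcm_period)
  have "?L > 0"
    using is_period_Lcm unfolding is_period_def by blast
  have "?L dvd P k"
  proof (rule multiplicity_le_imp_dvd)
    show "?L \<noteq> 0"
      using \<open>?L > 0\<close> by simp
    fix p :: nat assume "prime p"
    show "multiplicity p ?L \<le> multiplicity p (P k)"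
    proof (cases "p dvd ?L")
      case True
      have "multiplicity p ?L \<le> multiplicity p (lcm (k + 1) (P k))"
        using dvd pos by (intro dvd_imp_multiplicity_le) (auto simp: lcm_eq_0_iff)
      also have "\<dots> = max (multiplicity p (k + 1)) (multiplicity p (P k))"
        using pos by (intro multiplicity_lcm) (auto simp: \<open>prime p\<close>)
      finally show ?thesis
        using assms[OF \<open>prime p\<close> True] by simp
    qed (simp add: not_dvd_imp_multiplicity_0)
  qed
  moreover have "P k \<le> ?L"
    unfolding P_def using is_period_Lcm by (rule Least_le)
  ultimately show ?thesis
    using pos by (meson dvd_imp_le le_antisym)
qed

text \<open>Places \<open>p ^ (r + 1)\<close> in the range up to \<open>6 ^ r - 1\<close> for
  \<open>p \<le> 3\<close>. The inequality fails for \<open>r = 1\<close>, where 9 exceeds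
  6.\<close>

lemma three_power_less_six_power:
  assumes "r \<ge> 2"
  shows "(3::nat) ^ (r + 1) < 6 ^ r"
  using assms by (induction r rule: dec_induct) auto

lemma P_six_power:
  assumes "r \<ge> 2"
  shows "P (6 ^ r - 1) = Lcm {1..6 ^ r - 1}"
proof (rule P_eq_Lcm)
  fix p :: nat
  let ?L = "Lcm {1..6 ^ r - 1 :: nat}"
  assume "prime p" and p: "p dvd ?L"
  have L: "?L \<noteq> 0"
    by (auto simp: Lcm_0_iff)
  have mult_six: "multiplicity p (6 ^ r :: nat) = r * multiplicity p 6"
    using \<open>prime p\<close> by (simp add: prime_elem_multiplicity_power_distrib)
  show "multiplicity p (6 ^ r - 1 + 1) < multiplicity p ?L"
  proof (cases "p dvd 6")
    case True
    have "p dvd 2 * 3"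
      using True by simp
    then have "p dvd 2 \<or> p dvd 3"
      using \<open>prime p\<close> by (simp only: prime_dvd_mult_iff)
    then have "p \<le> 3"
      by (auto dest: dvd_imp_le)
    then have "p = 2 \<or> p = 3"
      using prime_ge_2_nat[OF \<open>prime p\<close>] by linarith
    \<comment> \<open>Since 6 is squarefree, \<open>p\<close> occurs at most \<open>r\<close> times
      in \<open>6 ^ r\<close>, so one extra power of \<open>p\<close> in \<open>?L\<close>
      suffices.\<close>
    then have "\<not> p ^ 2 dvd 6"
      by auto
    then have "multiplicity p 6 < 2"
      using \<open>prime p\<close> by (intro multiplicity_lessI) auto
    then have "r * multiplicity p 6 \<le> r * 1"
      by (intro mult_le_mono2) simp
    then have m: "multiplicity p (6 ^ r) \<le> r"
      using mult_six by simp
    have "p ^ (r + 1) \<le> 3 ^ (r + 1)"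
      using \<open>p \<le> 3\<close> by (intro power_mono) auto
    then have "p ^ (r + 1) \<in> {1..6 ^ r - 1}"
      using three_power_less_six_power[OF assms] prime_gt_0_nat[OF \<open>prime p\<close>] by auto
    then have "r + 1 \<le> multiplicity p ?L"
      using L \<open>prime p\<close> by (intro multiplicity_geI dvd_Lcm) auto
    then show ?thesis
      using m by simp
  next
    case False
    then have "multiplicity p (6 ^ r :: nat) = 0"
      using mult_six by (simp add: not_dvd_imp_multiplicity_0)
    moreover have "multiplicity p ?L > 0"
      using p L \<open>prime p\<close> by (simp add: prime_multiplicity_gt_zero_iff)
    ultimately show ?thesis
      by simp
  qed
qed

theorem corollary2p6:
  shows "(\<forall>k r :: nat. r \<ge> 2 \<and> k = 6 ^ r - 1 \<longrightarrow> P k = Lcm {1..k}) \<and>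
         infinite {k :: nat. \<not> prime (k + 1) \<and> P k = Lcm {1..k}}"
proof
  show "\<forall>k r :: nat. r \<ge> 2 \<and> k = 6 ^ r - 1 \<longrightarrow> P k = Lcm {1..k}"
    using P_six_power by blast
  have "inj_on (\<lambda>r. 6 ^ r - 1 :: nat) {2..}"
  proof (rule inj_onI)
    fix r s :: nat assume "6 ^ r - 1 = (6 ^ s - 1 :: nat)"
    then have "6 ^ r = (6 ^ s :: nat)"
      by (simp add: eq_diff_iff)
    then show "r = s"
      by simp
  qed
  then have "infinite ((\<lambda>r. 6 ^ r - 1 :: nat) ` {2..})"
    using finite_imageD infinite_Ici by blast
  \<comment> \<open>Here \<open>k + 1 = 6 ^ r\<close> is a proper power and so not prime.\<close>
  moreover have "(\<lambda>r. 6 ^ r - 1) ` {2..} \<subseteq> {k :: nat. \<not> prime (k + 1) \<and> P k = Lcm {1..k}}"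
    using P_six_power by (auto simp: prime_power_iff)
  ultimately show "infinite {k :: nat. \<not> prime (k + 1) \<and> P k = Lcm {1..k}}"
    using finite_subset by blast
qed

end
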